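(* Let $m \in \mathbb{N}$ ($m\ge 1$) and $\ell \in \{m-1,m\}$. As $\alpha \uparrow 1$, $\hat{r}_{m,\ell}(z,\alpha)$ converges coefficient-wise to $p_{m,\ell}(z)$, the type $(m,\ell)$ Padé approximant of $\sqrt{z}$ at $z=1$.
   Context: A rational function is of type $(m,\ell)$ if it is a ratio of polynomials (with real coefficients) of degree at most $m$ (numerator) and $\ell$ (denominator); $\mathcal{R}_{m,\ell}$ is the set of these. For $m \ge 1$, $\ell \in \{m-1,m\}$, $\alpha \in (0,1)$, $r_{m,\ell}(z,\alpha)$ is the (unique) $r\in\mathcal{R}_{m,\ell}$ minimizing $\max_{z \in [\alpha^2,1]} |(r(z)-\sqrt{z})/\sqrt{z}|$, and $\hat{r}_{m,\ell}(z,\alpha)$ is the unique scalar multiple of $r_{m,\ell}(z,\alpha)$ with $\min_{z \in [\alpha^2,1]} (\hat{r}_{m,\ell}(z,\alpha)-\sqrt{z})/\sqrt{z} = 0$. A family of functions $\{r(\cdot,\alpha) \in \mathcal{R}_{m,\ell} : \alpha \in (0,1)\}$ converges coefficient-wise to a function $p \in \mathcal{R}_{m,\ell}$ as $\alpha \uparrow 1$ if the coefficients of the polynomials in the numerator and denominator of $r(z,\alpha)$, appropriately normalized, approach the corresponding coefficients in $p(z)$ as $\alpha \uparrow 1$. The type $(m,\ell)$ Padé approximant of $\sqrt z$ at $z=1$ is the element $p_{m,\ell}\in\mathcal{R}_{m,\ell}$ with $\sqrt{z}-p_{m,\ell}(z)=O((z-1)^{m+\ell+1})$ as $z\to1$.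 *)

theory Defs
  imports
    "HOL-Analysis.Analysis"
    "HOL-Computational_Algebra.Computational_Algebra"
    "HOL-Library.Landau_Symbols"
begin

text \<open>
  A real rational function is represented by the function \<open>z \<mapsto> p(z)/q(z)\<close> of its reduced form.
  Coprimality costs no generality (cancelling common factors does not raise the degrees) and makes
  the representation faithful: since \<open>x / 0 = 0\<close>, an unreduced quotient would take a spurious
  value \<open>0\<close> at a removable singularity. The pair \<open>(p, q)\<close> is determined by the function up to a
  common nonzero scalar.
\<close>

definition is_quotient :: "nat \<Rightarrow> nat \<Rightarrow> real poly \<Rightarrow> real poly \<Rightarrow> (real \<Rightarrow> real) \<Rightarrow> bool" where
  "is_quotient m l p q r \<longleftrightarrow>
     degree p \<le> m \<and> degree q \<le> l \<and> q \<noteq> 0 \<and> coprime p q \<and> r = (\<lambda>z. poly p z / poly q z)"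

definition rat_type :: "nat \<Rightarrow> nat \<Rightarrow> (real \<Rightarrow> real) set" where
  "rat_type m l = {r. \<exists>p q. is_quotient m l p q r}"

definition rel_error :: "(real \<Rightarrow> real) \<Rightarrow> real \<Rightarrow> real" where
  "rel_error r z = (r z - sqrt z) / sqrt z"

text \<open>
  The supremum is taken in \<^typ>\<open>ereal\<close>: it is the maximum if \<open>r\<close> has no pole in \<open>[\<alpha>\<^sup>2, 1]\<close>,
  and \<open>\<infinity>\<close> otherwise, as \<open>r\<close> is then unbounded near the pole.
\<close>

definition max_rel_error :: "real \<Rightarrow> (real \<Rightarrow> real) \<Rightarrow> ereal" where
  "max_rel_error \<alpha> r = (SUP z\<in>{\<alpha>\<^sup>2..1}. ereal \<bar>rel_error r z\<bar>)"

definition is_best_approx :: "nat \<Rightarrow> nat \<Rightarrow> real \<Rightarrow> (real \<Rightarrow> real) \<Rightarrow> bool" where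
  "is_best_approx m l \<alpha> r \<longleftrightarrow> is_arg_min (max_rel_error \<alpha>) (\<lambda>s. s \<in> rat_type m l) r"

text \<open>The last two conjuncts say that the minimum of the signed relative error is attained and is \<open>0\<close>.\<close>

definition is_scaled_best_approx :: "nat \<Rightarrow> nat \<Rightarrow> real \<Rightarrow> (real \<Rightarrow> real) \<Rightarrow> bool" where
  "is_scaled_best_approx m l \<alpha> s \<longleftrightarrow>
     (\<exists>r c. is_best_approx m l \<alpha> r \<and> s = (\<lambda>z. c * r z)) \<and>
     (\<forall>z\<in>{\<alpha>\<^sup>2..1}. 0 \<le> rel_error s z) \<and>
     (\<exists>z\<in>{\<alpha>\<^sup>2..1}. rel_error s z = 0)"

definition is_pade_sqrt :: "nat \<Rightarrow> nat \<Rightarrow> (real \<Rightarrow> real) \<Rightarrow> bool" where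
  "is_pade_sqrt m l p \<longleftrightarrow>
     p \<in> rat_type m l \<and> (\<lambda>z. sqrt z - p z) \<in> O[at 1](\<lambda>z. (z - 1) ^ (m + l + 1))"

text \<open>
  Numerators and denominators are unique up to a common scalar, so the choice of \<open>P\<close>, \<open>Q\<close>, \<open>P0\<close>,
  \<open>Q0\<close> below is exactly a choice of normalization.
\<close>

definition converges_coeffwise ::
    "nat \<Rightarrow> nat \<Rightarrow> (real \<Rightarrow> real \<Rightarrow> real) \<Rightarrow> (real \<Rightarrow> real) \<Rightarrow> bool" where
  "converges_coeffwise m l r p \<longleftrightarrow>
     (\<exists>P Q P0 Q0.
        (\<forall>\<alpha>\<in>{0<..<1}. is_quotient m l (P \<alpha>) (Q \<alpha>) (r \<alpha>)) \<and>
        is_quotient m l P0 Q0 p \<and>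
        (\<forall>i. ((\<lambda>\<alpha>. coeff (P \<alpha>) i) \<longlongrightarrow> coeff P0 i) (at_left 1)) \<and>
        (\<forall>i. ((\<lambda>\<alpha>. coeff (Q \<alpha>) i) \<longlongrightarrow> coeff Q0 i) (at_left 1)))"

end

theory Submission
  imports Defs "HOL-Computational_Algebra.Field_as_Ring"
begin

text \<open>
  Put \<open>n = m + l + 1\<close> and let \<open>A (w\<^sup>2)\<close> and \<open>w B (w\<^sup>2)\<close> be the even and the odd part of
  \<open>(1 + w) ^ n\<close>, so that \<open>A (w\<^sup>2) - w B (w\<^sup>2) = (1 - w) ^ n\<close>. With \<open>w = \<surd>z\<close> this says that
  \<open>A / B\<close> agrees with \<open>\<surd>z\<close> to order \<open>n\<close> at \<open>1\<close>; since \<open>l\<close> is \<open>m - 1\<close> or \<open>m\<close>, the degrees of \<open>A\<close>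
  and \<open>B\<close> are exactly \<open>m\<close> and \<open>l\<close>, and \<open>A / B\<close> is the Pade approximant.

  Let \<open>h = 1 - \<alpha>\<^sup>2\<close> be the length of the interval. On it the relative error of \<open>A / B\<close> is \<open>O(h ^ n)\<close>.
  A best approximant is at least as good, and the scaling that makes its error one-sided changes
  the error by a bounded factor only. So the scaled best approximant \<open>P / Q\<close> is within
  \<open>O(h ^ n)\<close> of \<open>\<surd>z\<close>, and therefore of \<open>A / B\<close>. If \<open>Q\<close> is normalized to have bounded coefficients,
  the cross difference \<open>P B - A Q\<close> is \<open>O(h ^ n)\<close> on the interval \<open>[1 - h, 1]\<close>, while its degree is at
  most \<open>m + l = n - 1\<close>. Stretching the interval to unit length multiplies the \<open>k\<close>-th Taylor
  coefficient at \<open>1\<close> by \<open>h ^ k\<close>, with \<open>k \<le> n - 1\<close>, so each Taylor coefficient is \<open>O(h ^ (n - k))\<close> and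
  tends to \<open>0\<close>.

  It remains to pass from \<open>P B - A Q \<rightarrow> 0\<close> to the convergence of \<open>P\<close> and \<open>Q\<close> themselves. This is where
  it matters that the Pade approximant is nondegenerate: \<open>A\<close> and \<open>B\<close> are coprime and \<open>B\<close> has the full
  degree \<open>l\<close>. If \<open>U A + V B = 1\<close>, then \<open>Q\<close> is congruent to \<open>- U (P B - A Q)\<close> modulo \<open>B\<close>, so the
  remainder of \<open>Q\<close> modulo \<open>B\<close> tends to \<open>0\<close>; and the quotient is a scalar, by which one normalizes.
  The two facts about cross differences are \<open>coeff_tendsto_0_if_small_on_shrinking_interval\<close> and
  \<open>normalized_quotients_tendsto\<close>.
\<close>

section \<open>Coefficientwise convergence of polynomials\<close>

text \<open>
  On polynomials of bounded degree every linear functional is continuous for coefficientwise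
  convergence. It is applied to the coefficients of composites, products, quotients and remainders
  in which the other polynomial is fixed.
\<close>

lemma functional_tendsto_0:
  fixes E :: "'a \<Rightarrow> real poly" and T :: "real poly \<Rightarrow> real"
  assumes add: "\<And>f g. T (f + g) = T f + T g"
    and scale: "\<And>c f. T (smult c f) = c * T f"
    and deg: "\<And>x. degree (E x) \<le> N"
    and lim: "\<And>k. ((\<lambda>x. coeff (E x) k) \<longlongrightarrow> 0) F"
  shows "((\<lambda>x. T (E x)) \<longlongrightarrow> 0) F"
proof -
  have T0: "T 0 = 0"
    using scale[of 0 0] by simp
  have Tsum: "T (\<Sum>i\<in>I. f i) = (\<Sum>i\<in>I. T (f i))" if "finite I" for f and I :: "nat set"
    using that by (induction I) (simp_all add: T0 add)
  have expand: "T (E x) = (\<Sum>i\<le>N. coeff (E x) i * T (monom 1 i))" for x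
  proof -
    have "E x = (\<Sum>i\<le>N. monom (coeff (E x) i) i)"
      using poly_as_sum_of_monoms'[OF deg] by simp
    also have "\<dots> = (\<Sum>i\<le>N. smult (coeff (E x) i) (monom 1 i))"
      by (simp add: smult_monom)
    finally have "T (E x) = T (\<Sum>i\<le>N. smult (coeff (E x) i) (monom 1 i))"
      by (rule arg_cong)
    then show ?thesis
      by (simp add: Tsum scale)
  qed
  have "((\<lambda>x. \<Sum>i\<le>N. coeff (E x) i * T (monom 1 i)) \<longlongrightarrow> (\<Sum>i\<le>N. 0 * T (monom 1 i))) F"
    by (intro tendsto_intros lim)
  then show ?thesis
    by (simp add: expand)
qed

text \<open>
  A polynomial of degree less than \<open>card X\<close> depends linearly on its values on \<open>X\<close>. The induction
  is Newton interpolation: dividing out one node \<open>a\<close> leaves a polynomial whose values at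
  the other nodes are difference quotients. The degree bound is phrased in terms of coefficients so
  that it includes the zero polynomial when \<open>X\<close> is empty.
\<close>

lemma coeff_tendsto_0_if_values_tendsto_0:
  fixes E :: "'a \<Rightarrow> real poly"
  assumes "finite X"
    and "\<And>x k. k \<ge> card X \<Longrightarrow> coeff (E x) k = 0"
    and "\<And>a. a \<in> X \<Longrightarrow> ((\<lambda>x. poly (E x) a) \<longlongrightarrow> 0) F"
  shows "((\<lambda>x. coeff (E x) k) \<longlongrightarrow> 0) F"
  using assms
proof (induction X arbitrary: E k rule: finite_induct)
  case empty
  then show ?case by simp
next
  case (insert a X)
  define S where "S x = synthetic_div (E x) a" for x
  have split: "E x = [:- a, 1:] * S x + [:poly (E x) a:]" for x
    unfolding S_def by (rule synthetic_div_correct'[symmetric])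
  have "coeff (S x) j = 0" if "j \<ge> card X" for x j
  proof (cases "S x = 0")
    case False
    have "degree (E x) < Suc (card X)"
    proof (rule ccontr)
      assume *: "\<not> ?thesis"
      then have "coeff (E x) (degree (E x)) = 0"
        using insert by auto
      then show False using * by auto
    qed
    moreover have "degree (E x) \<noteq> 0"
      using False by (simp add: S_def synthetic_div_eq_0_iff)
    ultimately have "degree (S x) < card X"
      by (simp add: S_def degree_synthetic_div)
    with that show ?thesis
      by (simp add: coeff_eq_0)
  qed simp
  moreover have "((\<lambda>x. poly (S x) b) \<longlongrightarrow> 0) F" if "b \<in> X" for b
  proof -
    have ne: "b - a \<noteq> 0"
      using that insert.hyps by auto
    have "poly (E x) b = (b - a) * poly (S x) b + poly (E x) a" for x
      by (subst split) (simp add: algebra_simps)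
    then have "poly (S x) b = (poly (E x) b - poly (E x) a) / (b - a)" for x
      using ne by (simp add: field_simps)
    moreover have "((\<lambda>x. (poly (E x) b - poly (E x) a) / (b - a)) \<longlongrightarrow> (0 - 0) / (b - a)) F"
      using ne that by (intro tendsto_intros insert.prems) auto
    ultimately show ?thesis by simp
  qed
  ultimately have S: "((\<lambda>x. coeff (S x) j) \<longlongrightarrow> 0) F" for j
    by (rule insert.IH)
  have Ea: "((\<lambda>x. poly (E x) a) \<longlongrightarrow> 0) F"
    by (rule insert.prems) simp
  show ?case
  proof (cases k)
    case 0
    have "coeff (E x) k = poly (E x) a - a * coeff (S x) 0" for x
      by (subst split) (simp add: 0)
    moreover have "((\<lambda>x. poly (E x) a - a * coeff (S x) 0) \<longlongrightarrow> 0 - a * 0) F"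
      by (intro tendsto_intros Ea S)
    ultimately show ?thesis by simp
  next
    case (Suc j)
    have "coeff (E x) k = coeff (S x) j - a * coeff (S x) k" for x
      by (subst split) (simp add: Suc)
    moreover have "((\<lambda>x. coeff (S x) j - a * coeff (S x) k) \<longlongrightarrow> 0 - a * 0) F"
      by (intro tendsto_intros S)
    ultimately show ?thesis by simp
  qed
qed

text \<open>
  The substitution \<open>z = 1 - h t\<close>, divided by \<open>h ^ N\<close>, yields polynomials in \<open>t\<close> of size \<open>O(h)\<close>
  on \<open>(0, 1]\<close>, so their coefficients tend to \<open>0\<close>. Undoing the substitution multiplies the
  \<open>k\<close>-th coefficient by \<open>h ^ (N - k)\<close>, up to sign, and \<open>k \<le> N\<close>. The end point \<open>z = 1\<close> is left out
  of the hypothesis because asymptotic estimates at \<open>1\<close> say nothing about it.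
\<close>

lemma coeff_tendsto_0_if_small_on_shrinking_interval:
  fixes D :: "'a \<Rightarrow> real poly" and h :: "'a \<Rightarrow> real"
  assumes deg: "\<And>x. degree (D x) \<le> N"
    and h0: "(h \<longlongrightarrow> 0) F" and hpos: "\<forall>\<^sub>F x in F. 0 < h x"
    and small: "\<forall>\<^sub>F x in F. \<forall>z\<in>{1 - h x..<1}. \<bar>poly (D x) z\<bar> \<le> C * h x ^ Suc N"
  shows "((\<lambda>x. coeff (D x) k) \<longlongrightarrow> 0) F"
proof -
  define G where "G x = D x \<circ>\<^sub>p [:1, - 1:]" for x
  define E where "E x = smult (1 / h x ^ N) (G x \<circ>\<^sub>p [:0, h x:])" for x
  \<comment> \<open>Any \<open>N + 1\<close> points of \<open>(0, 1]\<close> serve as nodes.\<close>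
  define X where "X = (\<lambda>i. 1 / real (Suc i)) ` {..N}"
  have degG: "degree (G x) \<le> N" for x
    using deg[of x] by (simp add: G_def degree_pcompose)
  have cE: "coeff (E x) j = h x ^ j * coeff (G x) j / h x ^ N" for x j
    by (simp add: E_def coeff_pcompose_linear)
  have card: "card X = Suc N"
    unfolding X_def by (subst card_image) (auto simp: inj_on_def)
  have "((\<lambda>x. coeff (E x) j) \<longlongrightarrow> 0) F" for j
  proof (rule coeff_tendsto_0_if_values_tendsto_0[where X = X])
    show "finite X" by (simp add: X_def)
    show "coeff (E x) j = 0" if "card X \<le> j" for x j
      using degG[of x] that card by (simp add: cE coeff_eq_0)
    show "((\<lambda>x. poly (E x) a) \<longlongrightarrow> 0) F" if "a \<in> X" for a
    proof (rule Lim_null_comparison)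
      have a: "0 < a" "a \<le> 1" using that by (auto simp: X_def)
      show "\<forall>\<^sub>F x in F. norm (poly (E x) a) \<le> C * h x"
        using small hpos
      proof eventually_elim
        case (elim x)
        have "1 - h x * a \<in> {1 - h x..<1}"
          using a elim by (auto simp: mult_le_cancel_left1)
        then have "\<bar>poly (D x) (1 - h x * a)\<bar> \<le> C * h x ^ Suc N"
          using elim by blast
        moreover have "poly (E x) a = poly (D x) (1 - h x * a) / h x ^ N"
          by (simp add: E_def G_def poly_pcompose algebra_simps)
        ultimately show ?case
          using elim by (simp add: abs_mult pos_divide_le_eq mult.assoc)
      qed
      show "((\<lambda>x. C * h x) \<longlongrightarrow> 0) F"
        using tendsto_mult_right_zero[OF h0] .
    qed
  qed
  then have E: "((\<lambda>x. coeff (E x) j) \<longlongrightarrow> 0) F" for j .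
  have G: "((\<lambda>x. coeff (G x) j) \<longlongrightarrow> 0) F" for j
  proof (cases "j \<le> N")
    case True
    have "((\<lambda>x. coeff (E x) j * h x ^ (N - j)) \<longlongrightarrow> 0 * 0 ^ (N - j)) F"
      by (intro tendsto_intros E h0)
    then have "((\<lambda>x. coeff (E x) j * h x ^ (N - j)) \<longlongrightarrow> 0) F"
      by simp
    moreover have "\<forall>\<^sub>F x in F. coeff (E x) j * h x ^ (N - j) = coeff (G x) j"
      using hpos
    proof eventually_elim
      case (elim x)
      have "h x ^ N = h x ^ j * h x ^ (N - j)"
        using True by (simp flip: power_add)
      then show ?case using elim by (simp add: cE)
    qed
    ultimately show ?thesis
      by (rule Lim_transform_eventually)
  next
    case False
    then have "coeff (G x) j = 0" for x
      using degG[of x] by (simp add: coeff_eq_0)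
    then show ?thesis by simp
  qed
  have D: "D x = G x \<circ>\<^sub>p [:1, - 1:]" for x
    by (simp add: G_def flip: pcompose_assoc) (simp add: pcompose_pCons pcompose_idR)
  show ?thesis
    unfolding D
    by (rule functional_tendsto_0[OF _ _ degG G]) (simp_all add: pcompose_add pcompose_smult)
qed

lemma abs_poly_le_sum_coeffs:
  fixes f :: "real poly"
  assumes "degree f \<le> l" "\<bar>z\<bar> \<le> 1"
  shows "\<bar>poly f z\<bar> \<le> (\<Sum>i\<le>l. \<bar>coeff f i\<bar>)"
proof -
  have "poly f z = (\<Sum>i\<le>l. coeff f i * z ^ i)"
    unfolding poly_altdef using assms(1)
    by (intro sum.mono_neutral_left) (auto simp: coeff_eq_0)
  also have "\<bar>\<dots>\<bar> \<le> (\<Sum>i\<le>l. \<bar>coeff f i * z ^ i\<bar>)"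
    by (rule sum_abs)
  also have "\<dots> \<le> (\<Sum>i\<le>l. \<bar>coeff f i\<bar>)"
    using assms(2)
    by (intro sum_mono) (auto simp: abs_mult power_abs intro!: mult_left_le power_le_one)
  finally show ?thesis .
qed

section \<open>Stability of reduced quotients\<close>

lemma coprime_smult:
  fixes f g :: "real poly"
  assumes "c \<noteq> 0"
  shows "coprime (smult c f) g \<longleftrightarrow> coprime f g" and "coprime f (smult c g) \<longleftrightarrow> coprime f g"
  using assms by (simp_all add: coprime_def dvd_smult_iff)

lemma quotient_normalize:
  assumes "is_quotient m l P Q r"
  shows "\<exists>P Q. is_quotient m l P Q r \<and> (\<Sum>i\<le>l. \<bar>coeff Q i\<bar>) = 1"
proof -
  define c where "c = (\<Sum>i\<le>l. \<bar>coeff Q i\<bar>)"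
  have Q: "Q \<noteq> 0" "degree Q \<le> l"
    using assms by (auto simp: is_quotient_def)
  have "\<bar>lead_coeff Q\<bar> \<le> c"
    unfolding c_def using Q by (intro member_le_sum) auto
  then have "c > 0"
    using Q by (smt (verit) leading_coeff_0_iff)
  then have "is_quotient m l (smult (1 / c) P) (smult (1 / c) Q) r"
    using assms by (auto simp: is_quotient_def coprime_smult)
  moreover have "(\<Sum>i\<le>l. \<bar>coeff (smult (1 / c) Q) i\<bar>) = 1"
    using \<open>c > 0\<close> by (simp add: abs_mult sum_divide_distrib[symmetric] c_def[symmetric])
  ultimately show ?thesis by blast
qed

text \<open>
  A coprime pair \<open>(A, B)\<close> is isolated, up to scaling, among the pairs \<open>(P, Q)\<close> with
  \<open>degree Q \<le> degree B\<close>: if the cross difference tends to \<open>0\<close>, then a multiple of \<open>(P, Q)\<close> tends to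
  \<open>(A, B)\<close>. The coefficient sum of \<open>Q\<close> is fixed to exclude that \<open>(P, Q)\<close> itself tends to \<open>0\<close>.
\<close>

lemma normalized_quotients_tendsto:
  fixes A B :: "real poly" and P Q :: "'a \<Rightarrow> real poly"
  assumes cop: "coprime A B" and "B \<noteq> 0"
    and degP: "\<And>x. degree (P x) \<le> m" and degQ: "\<And>x. degree (Q x) \<le> degree B"
    and norm: "\<And>x. (\<Sum>i\<le>degree B. \<bar>coeff (Q x) i\<bar>) = 1"
    and lim: "\<And>k. ((\<lambda>x. coeff (P x * B - A * Q x) k) \<longlongrightarrow> 0) F"
  obtains u where "\<And>x. u x \<noteq> 0"
    and "\<And>k. ((\<lambda>x. coeff (smult (u x) (P x)) k) \<longlongrightarrow> coeff A k) F"
    and "\<And>k. ((\<lambda>x. coeff (smult (u x) (Q x)) k) \<longlongrightarrow> coeff B k) F"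
proof -
  define l where "l = degree B"
  define N where "N = max (m + l) (degree A + l)"
  define D where "D x = P x * B - A * Q x" for x
  have degD: "degree (D x) \<le> N" for x
    unfolding D_def N_def
    using degP[of x] degQ[of x] degree_mult_le[of "P x" B] degree_mult_le[of A "Q x"]
    by (intro degree_diff_le) (auto simp: l_def)
  have D: "((\<lambda>x. coeff (D x) k) \<longlongrightarrow> 0) F" for k
    unfolding D_def by (rule lim)
  \<comment> \<open>Because \<open>degree Q \<le> degree B\<close>, the quotient of \<open>Q\<close> by \<open>B\<close> is the scalar \<open>t\<close>, and \<open>R\<close> is the remainder.\<close>
  define t where "t x = coeff (Q x) l / lead_coeff B" for x
  define R where "R x = Q x - smult (t x) B" for x
  obtain U V where bez: "U * A + V * B = 1"
    using cop by (metis bezout_coefficients_fst_snd coprime_iff_gcd_eq_1)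
  have "R x = (- U * D x) mod B" for x
  proof -
    have "Q x = (U * A + V * B) * Q x"
      by (simp add: bez)
    then have "Q x = - U * D x + (U * P x + V * Q x) * B"
      by (simp add: D_def algebra_simps)
    then have 1: "R x = - U * D x + (U * P x + V * Q x - [:t x:]) * B"
      by (simp add: R_def algebra_simps)
    have "coeff (R x) l = 0"
      using \<open>B \<noteq> 0\<close> by (simp add: R_def t_def l_def)
    moreover have "degree (R x) \<le> l"
      unfolding R_def using degQ[of x] degree_smult_le[of "t x" B]
      by (intro degree_diff_le) (auto simp: l_def)
    ultimately have "R x = 0 \<or> degree (R x) < degree B"
      by (metis l_def leading_coeff_0_iff order_le_less)
    then have "R x = R x mod B"
      by (metis mod_0 mod_poly_less)
    also have "\<dots> = (- U * D x) mod B"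
      by (subst 1) (rule mod_mult_self1)
    finally show ?thesis .
  qed
  moreover have "((\<lambda>x. coeff ((- U * D x) mod B) k) \<longlongrightarrow> 0) F" for k
    by (rule functional_tendsto_0[OF _ _ degD D])
      (simp_all add: poly_mod_diff_left mod_smult_left distrib_left)
  ultimately have R: "((\<lambda>x. coeff (R x) k) \<longlongrightarrow> 0) F" for k
    by simp

  \<comment> \<open>As \<open>R\<close> tends to \<open>0\<close> while the coefficient sum of \<open>Q = t B + R\<close> is \<open>1\<close>, the scalar \<open>t\<close> stays away from \<open>0\<close>.\<close>
  define b where "b = (\<Sum>i\<le>l. \<bar>coeff B i\<bar>)"
  have "\<bar>coeff B l\<bar> \<le> b"
    unfolding b_def by (rule member_le_sum) auto
  moreover have "\<bar>coeff B l\<bar> > 0"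
    using \<open>B \<noteq> 0\<close> by (simp add: l_def)
  ultimately have "b > 0"
    by linarith
  have "((\<lambda>x. \<Sum>i\<le>l. \<bar>coeff (R x) i\<bar>) \<longlongrightarrow> (\<Sum>i\<le>l. \<bar>0\<bar>)) F"
    by (intro tendsto_intros R)
  then have "\<forall>\<^sub>F x in F. (\<Sum>i\<le>l. \<bar>coeff (R x) i\<bar>) < 1 / 2"
    by (rule order_tendstoD(2)) simp
  then have tbig: "\<forall>\<^sub>F x in F. 1 / (2 * b) \<le> \<bar>t x\<bar>"
  proof eventually_elim
    case (elim x)
    have "1 = (\<Sum>i\<le>l. \<bar>coeff (R x) i + t x * coeff B i\<bar>)"
      using norm[of x] by (simp add: R_def l_def)
    also have "\<dots> \<le> (\<Sum>i\<le>l. \<bar>coeff (R x) i\<bar> + \<bar>t x\<bar> * \<bar>coeff B i\<bar>)"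
      by (intro sum_mono) (simp add: abs_mult[symmetric] abs_triangle_ineq)
    also have "\<dots> = (\<Sum>i\<le>l. \<bar>coeff (R x) i\<bar>) + \<bar>t x\<bar> * b"
      by (simp add: sum.distrib sum_distrib_left b_def)
    finally have "1 / 2 \<le> \<bar>t x\<bar> * b"
      using elim by linarith
    then show ?case
      using \<open>b > 0\<close> by (simp add: field_simps)
  qed

  define u where "u x = (if t x = 0 then 1 else 1 / t x)" for x
  have ut: "\<forall>\<^sub>F x in F. u x * t x = 1"
    using tbig by eventually_elim (use \<open>b > 0\<close> in \<open>auto simp: u_def field_simps\<close>)
  have ubound: "\<forall>\<^sub>F x in F. norm (u x) \<le> 2 * b"
    using tbig by eventually_elim (use \<open>b > 0\<close> in \<open>auto simp: u_def field_simps\<close>)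
  have scaled: "((\<lambda>x. u x * f x) \<longlongrightarrow> 0) F" if "(f \<longlongrightarrow> 0) F" for f
  proof (rule Lim_null_comparison)
    show "\<forall>\<^sub>F x in F. norm (u x * f x) \<le> 2 * b * norm (f x)"
      using ubound by eventually_elim (auto simp: abs_mult intro: mult_right_mono)
    show "((\<lambda>x. 2 * b * norm (f x)) \<longlongrightarrow> 0) F"
      using that by (intro tendsto_mult_right_zero tendsto_norm_zero)
  qed

  \<comment> \<open>The numerator follows from the denominator: \<open>(P - t A) B = D + A R\<close>, and division by \<open>B\<close> is linear.\<close>
  define W where "W x = D x + A * R x" for x
  have degR: "degree (R x) \<le> l" for x
    unfolding R_def using degQ[of x] degree_smult_le[of "t x" B]
    by (intro degree_diff_le) (auto simp: l_def)
  have "W x = (P x - smult (t x) A) * B" for x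
    by (simp add: W_def D_def R_def algebra_simps)
  then have W_div: "P x - smult (t x) A = W x div B" for x
    using \<open>B \<noteq> 0\<close> by simp
  have degW: "degree (W x) \<le> N" for x
    unfolding W_def
    using degD[of x] degR[of x] degree_mult_le[of A "R x"]
    by (intro degree_add_le) (auto simp: N_def)
  have "((\<lambda>x. coeff (A * R x) k) \<longlongrightarrow> 0) F" for k
    by (rule functional_tendsto_0[OF _ _ degR R]) (simp_all add: distrib_left)
  then have W: "((\<lambda>x. coeff (W x) k) \<longlongrightarrow> 0) F" for k
    unfolding W_def using tendsto_add[OF D] by fastforce
  have "((\<lambda>x. coeff (W x div B) k) \<longlongrightarrow> 0) F" for k
    by (rule functional_tendsto_0[OF _ _ degW W]) (simp_all add: poly_div_add_left div_smult_left)
  then have PA: "((\<lambda>x. coeff (P x - smult (t x) A) k) \<longlongrightarrow> 0) F" for k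
    by (simp add: W_div)

  have normalize: "((\<lambda>x. coeff (smult (u x) (Y x)) k) \<longlongrightarrow> coeff Z k) F"
    if "((\<lambda>x. coeff (Y x - smult (t x) Z) k) \<longlongrightarrow> 0) F" for Y Z k
  proof -
    have "((\<lambda>x. coeff Z k + u x * coeff (Y x - smult (t x) Z) k) \<longlongrightarrow> coeff Z k + 0) F"
      by (intro tendsto_intros scaled that)
    moreover have "\<forall>\<^sub>F x in F. coeff Z k + u x * coeff (Y x - smult (t x) Z) k
        = coeff (smult (u x) (Y x)) k"
      using ut
    proof eventually_elim
      case (elim x)
      have "u x * (t x * coeff Z k) = coeff Z k"
        using elim by (simp flip: mult.assoc)
      then show ?case
        by (simp add: right_diff_distrib)
    qed
    ultimately show ?thesis
      using Lim_transform_eventually by fastforce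
  qed
  show thesis
  proof
    show "u x \<noteq> 0" for x by (simp add: u_def)
    show "((\<lambda>x. coeff (smult (u x) (P x)) k) \<longlongrightarrow> coeff A k) F" for k
      by (rule normalize[OF PA])
    show "((\<lambda>x. coeff (smult (u x) (Q x)) k) \<longlongrightarrow> coeff B k) F" for k
      by (rule normalize) (use R in \<open>simp add: R_def\<close>)
  qed
qed

section \<open>The Pade approximants of the square root\<close>

text \<open>
  The even part of \<open>(1 + w) ^ n\<close> is \<open>binomial_even n\<close> at \<open>w\<^sup>2\<close>, and the odd part is \<open>w\<close> times
  \<open>binomial_odd n\<close> at \<open>w\<^sup>2\<close>.
\<close>

definition binomial_even :: "nat \<Rightarrow> real poly" where
  "binomial_even n = (\<Sum>k\<le>n. monom (of_nat (n choose (2 * k))) k)"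

definition binomial_odd :: "nat \<Rightarrow> real poly" where
  "binomial_odd n = (\<Sum>k\<le>n. monom (of_nat (n choose (2 * k + 1))) k)"

lemma coeff_binomial_even: "coeff (binomial_even n) k = of_nat (n choose (2 * k))"
  by (simp add: binomial_even_def coeff_sum)

lemma coeff_binomial_odd: "coeff (binomial_odd n) k = of_nat (n choose (2 * k + 1))"
  by (simp add: binomial_odd_def coeff_sum)

lemma binomial_even_0: "binomial_even 0 = 1"
  by (simp add: binomial_even_def)

lemma binomial_odd_0: "binomial_odd 0 = 0"
  by (simp add: binomial_odd_def)

lemma binomial_even_Suc: "binomial_even (Suc n) = binomial_even n + pCons 0 (binomial_odd n)"
  by (rule poly_eqI)
    (simp add: coeff_binomial_even coeff_binomial_odd coeff_pCons split: nat.split)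

lemma binomial_odd_Suc: "binomial_odd (Suc n) = binomial_even n + binomial_odd n"
  by (rule poly_eqI) (simp add: coeff_binomial_even coeff_binomial_odd)

lemma binomial_even_minus_odd:
  "poly (binomial_even n) (w\<^sup>2) - w * poly (binomial_odd n) (w\<^sup>2) = (1 - w) ^ n"
proof (induction n)
  case (Suc n)
  have "poly (binomial_even (Suc n)) (w\<^sup>2) - w * poly (binomial_odd (Suc n)) (w\<^sup>2)
      = (1 - w) * (poly (binomial_even n) (w\<^sup>2) - w * poly (binomial_odd n) (w\<^sup>2))"
    by (simp add: binomial_even_Suc binomial_odd_Suc algebra_simps power2_eq_square)
  with Suc show ?case by simp
qed (simp add: binomial_even_0 binomial_odd_0)

text \<open>
  This is the product of \<open>(1 + w) ^ n\<close> and its conjugate \<open>(1 - w) ^ n\<close>, written in \<open>z = w\<^sup>2\<close>. It shows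
  that a common divisor of the two parts can vanish only at \<open>1\<close>, where the even part is positive.
\<close>

lemma binomial_norm_form: "(binomial_even n)\<^sup>2 - pCons 0 ((binomial_odd n)\<^sup>2) = [:1, - 1:] ^ n"
proof (induction n)
  case (Suc n)
  have "(binomial_even (Suc n))\<^sup>2 - pCons 0 ((binomial_odd (Suc n))\<^sup>2)
      = [:1, - 1:] * ((binomial_even n)\<^sup>2 - pCons 0 ((binomial_odd n)\<^sup>2))"
  proof (rule poly_eq_poly_eq_iff[THEN iffD1], rule ext)
    fix z
    show "poly ((binomial_even (Suc n))\<^sup>2 - pCons 0 ((binomial_odd (Suc n))\<^sup>2)) z
      = poly ([:1, - 1:] * ((binomial_even n)\<^sup>2 - pCons 0 ((binomial_odd n)\<^sup>2))) z"
      by (simp add: binomial_even_Suc binomial_odd_Suc power2_eq_square algebra_simps)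
  qed
  with Suc show ?case by simp
qed (simp add: binomial_even_0 binomial_odd_0)

lemma binomial_even_ge_1: "z \<ge> 0 \<Longrightarrow> poly (binomial_even n) z \<ge> 1"
  and binomial_odd_nonneg: "z \<ge> 0 \<Longrightarrow> poly (binomial_odd n) z \<ge> 0"
  by (induction n) (auto simp: binomial_even_0 binomial_odd_0 binomial_even_Suc binomial_odd_Suc
      intro: add_increasing2)

lemma binomial_odd_ge_1: "z \<ge> 0 \<Longrightarrow> n \<ge> 1 \<Longrightarrow> poly (binomial_odd n) z \<ge> 1"
  using binomial_even_ge_1[of z "n - 1"] binomial_odd_nonneg[of z "n - 1"]
  by (cases n) (auto simp: binomial_odd_Suc)

lemma coprime_binomial_even_odd: "coprime (binomial_even n) (binomial_odd n)"
proof (rule coprimeI)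
  fix d assume d: "d dvd binomial_even n" "d dvd binomial_odd n"
  have "d dvd (binomial_even n)\<^sup>2 - [:0, 1:] * (binomial_odd n)\<^sup>2"
    using d by (intro dvd_diff dvd_mult) (auto simp: power2_eq_square)
  then have "d dvd [:1, - 1:] ^ n"
    by (simp add: binomial_norm_form)
  moreover have "coprime (binomial_even n) [:1, - 1:]"
  proof -
    have "poly (binomial_even n) 1 \<noteq> 0"
      using binomial_even_ge_1[of 1 n] by auto
    then have "\<not> [:-1, 1:] dvd binomial_even n"
      by (simp add: poly_eq_0_iff_dvd)
    moreover have "prime_elem [:-1, 1 :: real:]"
      by (simp add: prime_elem_linear_field_poly)
    ultimately have "coprime [:-1, 1:] (binomial_even n)"
      by (intro prime_elem_imp_coprime)
    moreover have minus: "[:1, - 1 :: real:] = - [:-1, 1:]"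
      by simp
    ultimately show ?thesis
      unfolding minus coprime_minus_right_iff by (simp only: coprime_commute)
  qed
  then have "coprime (binomial_even n) ([:1, - 1:] ^ n)"
    by simp
  ultimately show "is_unit d"
    using d(1) by (intro coprime_common_divisor)
qed

lemma
  fixes m l :: nat
  assumes l: "l \<in> {m - 1, m}" and m: "m \<ge> 1"
  shows degree_binomial_even: "degree (binomial_even (m + l + 1)) \<le> m"
    and degree_binomial_odd: "degree (binomial_odd (m + l + 1)) = l"
proof -
  show "degree (binomial_even (m + l + 1)) \<le> m"
    using l m by (intro degree_le) (auto simp: coeff_binomial_even simp del: binomial_Suc_Suc intro!: binomial_eq_0)
  show "degree (binomial_odd (m + l + 1)) = l"
  proof (rule antisym)
    show "degree (binomial_odd (m + l + 1)) \<le> l"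
      using l m by (intro degree_le) (auto simp: coeff_binomial_odd simp del: binomial_Suc_Suc intro!: binomial_eq_0)
    show "l \<le> degree (binomial_odd (m + l + 1))"
      using l m by (intro le_degree) (auto simp: coeff_binomial_odd simp del: binomial_Suc_Suc)
  qed
qed

text \<open>
  The difference is \<open>(1 - \<surd>z) ^ n\<close>, and \<open>z \<le> \<surd>z\<close> on the unit interval.
\<close>

lemma binomial_even_minus_odd_bound:
  assumes "0 \<le> z" "z \<le> 1"
  shows "\<bar>poly (binomial_even n) z - sqrt z * poly (binomial_odd n) z\<bar> \<le> (1 - z) ^ n"
proof -
  have "z \<le> sqrt z"
    using assms by (intro real_le_rsqrt) (simp add: power2_eq_square mult_left_le)
  moreover have "sqrt z \<le> 1"
    using assms by simp
  ultimately have "\<bar>(1 - sqrt z) ^ n\<bar> \<le> (1 - z) ^ n"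
    by (simp add: power_mono)
  then show ?thesis
    using binomial_even_minus_odd[of n "sqrt z"] assms by simp
qed

text \<open>
  If \<open>P / Q\<close> takes a value \<open>y\<close> near \<open>\<surd>z\<close>, then \<open>P B - A Q\<close> is \<open>Q\<close> times
  \<open>(y - \<surd>z) B - (A - \<surd>z B)\<close>, and both terms are small. This serves twice: for an arbitrary Pade
  approximant, to identify it, and for the scaled best approximants.
\<close>

lemma cross_difference_bound:
  fixes P Q :: "real poly" and y z e :: real and n l :: nat
  defines "A \<equiv> binomial_even n" and "B \<equiv> binomial_odd n"
  assumes z: "0 \<le> z" "z \<le> 1" and deg: "degree B \<le> l" "degree Q \<le> l"
    and y: "poly P z = y * poly Q z" "\<bar>y - sqrt z\<bar> \<le> e"
  shows "\<bar>poly (P * B - A * Q) z\<bar>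
    \<le> (\<Sum>i\<le>l. \<bar>coeff Q i\<bar>) * (e * (\<Sum>i\<le>l. \<bar>coeff B i\<bar>) + (1 - z) ^ n)"
proof -
  have "poly (P * B - A * Q) z
      = poly Q z * ((y - sqrt z) * poly B z - (poly A z - sqrt z * poly B z))"
    by (simp add: y algebra_simps)
  then have "\<bar>poly (P * B - A * Q) z\<bar>
      = \<bar>poly Q z\<bar> * \<bar>(y - sqrt z) * poly B z - (poly A z - sqrt z * poly B z)\<bar>"
    by (simp only: abs_mult)
  also have "\<dots> \<le> (\<Sum>i\<le>l. \<bar>coeff Q i\<bar>) * (e * (\<Sum>i\<le>l. \<bar>coeff B i\<bar>) + (1 - z) ^ n)"
  proof (rule mult_mono)
    show "\<bar>poly Q z\<bar> \<le> (\<Sum>i\<le>l. \<bar>coeff Q i\<bar>)"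
      using deg z by (intro abs_poly_le_sum_coeffs) auto
    have "\<bar>poly B z\<bar> \<le> (\<Sum>i\<le>l. \<bar>coeff B i\<bar>)"
      using deg z by (intro abs_poly_le_sum_coeffs) auto
    then have "\<bar>(y - sqrt z) * poly B z\<bar> \<le> e * (\<Sum>i\<le>l. \<bar>coeff B i\<bar>)"
      unfolding abs_mult using y(2) by (intro mult_mono) auto
    moreover have "\<bar>poly A z - sqrt z * poly B z\<bar> \<le> (1 - z) ^ n"
      unfolding A_def B_def using z by (rule binomial_even_minus_odd_bound)
    ultimately show "\<bar>(y - sqrt z) * poly B z - (poly A z - sqrt z * poly B z)\<bar>
        \<le> e * (\<Sum>i\<le>l. \<bar>coeff B i\<bar>) + (1 - z) ^ n"
      by linarith
  qed (auto intro: sum_nonneg)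
  finally show ?thesis .
qed

text \<open>
  If \<open>P / Q\<close> is a Pade approximant, then \<open>P B - A Q\<close> vanishes to order \<open>m + l + 1\<close> at \<open>1\<close>, which exceeds
  its degree; so it is \<open>0\<close>. As \<open>A\<close> and \<open>B\<close> are coprime, \<open>B\<close> divides \<open>Q\<close>, and the
  degrees leave room for a constant factor only.
\<close>

lemma pade_sqrt_is_binomial_quotient:
  fixes m l :: nat and p :: "real \<Rightarrow> real"
  defines "A \<equiv> binomial_even (m + l + 1)" and "B \<equiv> binomial_odd (m + l + 1)"
  assumes "m \<ge> 1" "l \<in> {m - 1, m}" and pade: "is_pade_sqrt m l p"
  shows "is_quotient m l A B p"
proof -
  define n where "n = m + l + 1"
  have degA: "degree A \<le> m" and degB: "degree B = l"
    unfolding A_def B_def using assms by (intro degree_binomial_even degree_binomial_odd; simp)+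
  have cop: "coprime A B"
    by (simp add: A_def B_def coprime_binomial_even_odd)
  have B0: "B \<noteq> 0"
    using binomial_odd_ge_1[of 0 n] by (auto simp: B_def n_def)
  obtain P Q where PQ: "is_quotient m l P Q p"
    using pade by (auto simp: is_pade_sqrt_def rat_type_def)
  define D where "D = P * B - A * Q"
  have degD: "degree D \<le> m + l"
    unfolding D_def using PQ degA degB degree_mult_le[of P B] degree_mult_le[of A Q]
    by (intro degree_diff_le) (auto simp: is_quotient_def)

  obtain C where "C > 0" and C: "\<forall>\<^sub>F z in at 1. \<bar>sqrt z - p z\<bar> \<le> C * \<bar>z - 1\<bar> ^ n"
    using pade unfolding is_pade_sqrt_def n_def
    by (elim conjE landau_o.bigE) (auto simp: power_abs simp del: power_Suc)
  define b where "b = (\<Sum>i\<le>l. \<bar>coeff B i\<bar>)"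
  define q where "q = (\<Sum>i\<le>l. \<bar>coeff Q i\<bar>)"
  have b0: "b \<ge> 0" and q0: "q \<ge> 0"
    by (simp_all add: b_def q_def sum_nonneg)
  have "open (- ({z. poly Q z = 0} - {1}))"
    using PQ poly_roots_finite[of Q] unfolding is_quotient_def
    by (intro open_Compl finite_imp_closed) simp
  then have "\<forall>\<^sub>F z in at 1. poly Q z \<noteq> 0"
    unfolding eventually_at_topological by (intro exI[of _ "- ({z. poly Q z = 0} - {1})"]) auto
  with C have "\<forall>\<^sub>F z in at_left 1. \<bar>sqrt z - p z\<bar> \<le> C * \<bar>z - 1\<bar> ^ n \<and> poly Q z \<noteq> 0"
    by (auto simp: eventually_at_split eventually_conj_iff)
  then obtain a where "a < 1"
    and a: "\<And>z. a < z \<Longrightarrow> z < 1 \<Longrightarrow> \<bar>sqrt z - p z\<bar> \<le> C * \<bar>z - 1\<bar> ^ n \<and> poly Q z \<noteq> 0"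
    by (auto simp: eventually_at_left_field)
  have bound: "\<bar>poly D z\<bar> \<le> q * (C * b + 1) * (1 - z) ^ n" if z: "a < z" "0 \<le> z" "z < 1" for z
  proof -
    have "poly P z = p z * poly Q z"
      using PQ a[of z] z by (simp add: is_quotient_def)
    moreover have "\<bar>p z - sqrt z\<bar> \<le> C * (1 - z) ^ n"
      using a[of z] z by (simp add: abs_minus_commute)
    ultimately have "\<bar>poly D z\<bar> \<le> q * (C * (1 - z) ^ n * b + (1 - z) ^ n)"
      unfolding D_def A_def B_def q_def b_def n_def
      using PQ degB z by (intro cross_difference_bound) (auto simp: is_quotient_def B_def)
    then show ?thesis
      by (simp add: algebra_simps)
  qed
  \<comment> \<open>The family is constant, so convergence of its coefficients to \<open>0\<close> means \<open>D = 0\<close>.\<close>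
  have "((\<lambda>h. coeff D k) \<longlongrightarrow> 0) (at_right (0::real))" for k
  proof (rule coeff_tendsto_0_if_small_on_shrinking_interval[where h = "\<lambda>h. h"])
    show "\<forall>\<^sub>F h in at_right 0. \<forall>z\<in>{1 - h..<1}. \<bar>poly D z\<bar> \<le> q * (C * b + 1) * h ^ Suc (m + l)"
    proof (rule eventually_mono)
      show "\<forall>\<^sub>F h in at_right 0. h \<in> {0<..<min 1 (1 - a)}"
        using \<open>a < 1\<close> by (intro eventually_at_right_real) auto
      fix h assume h: "h \<in> {0<..<min 1 (1 - a)}"
      show "\<forall>z\<in>{1 - h..<1}. \<bar>poly D z\<bar> \<le> q * (C * b + 1) * h ^ Suc (m + l)"
      proof
        fix z assume "z \<in> {1 - h..<1}"
        then have z: "a < z" "0 \<le> z" "z < 1" "1 - z \<le> h"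
          using h by auto
        have "q * (C * b + 1) * (1 - z) ^ n \<le> q * (C * b + 1) * h ^ n"
          using z \<open>C > 0\<close> b0 q0 by (intro mult_left_mono power_mono) auto
        with bound[of z] z show "\<bar>poly D z\<bar> \<le> q * (C * b + 1) * h ^ Suc (m + l)"
          by (simp add: n_def)
      qed
    qed
  qed (use degD in \<open>auto simp: eventually_at_right_less intro: tendsto_ident_at\<close>)
  then have "D = 0"
    by (intro poly_eqI) (simp add: tendsto_const_iff)
  then have eq: "P * B = A * Q"
    by (simp add: D_def)
  then have "B dvd Q"
    using cop by (metis coprime_commute coprime_dvd_mult_right_iff dvd_triv_right)
  then obtain g where g: "Q = B * g" ..
  have Q0: "Q \<noteq> 0" and degQ: "degree Q \<le> l"
    using PQ by (auto simp: is_quotient_def)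
  have "g \<noteq> 0" "degree g = 0"
    using g Q0 degQ degB B0 by (auto simp: degree_mult_eq)
  then obtain c where c: "g = [:c:]" "c \<noteq> 0"
    by (metis degree_0_id degree_eq_zeroE pCons_0_0)
  have P: "P = A * g"
    using eq B0 by (simp add: g ac_simps)
  have "p = (\<lambda>z. poly A z / poly B z)"
    using PQ c by (auto simp: is_quotient_def P g)
  then show ?thesis
    using degA degB cop B0 by (simp add: is_quotient_def)
qed

section \<open>Scaled best approximants are close to the square root\<close>

text \<open>
  The scaling factor is nonzero, since a scaled best approximant is at least \<open>1\<close> at the point \<open>1\<close>.
\<close>

lemma scaled_best_approx_is_quotient:
  assumes "0 < \<alpha>" "\<alpha> < 1" "is_scaled_best_approx m l \<alpha> s"
  shows "\<exists>P Q. is_quotient m l P Q s"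
proof -
  obtain r c where r: "is_best_approx m l \<alpha> r" and s: "s = (\<lambda>z. c * r z)"
    and err: "\<forall>z\<in>{\<alpha>\<^sup>2..1}. 0 \<le> rel_error s z"
    using assms by (auto simp: is_scaled_best_approx_def)
  have "0 \<le> rel_error s 1"
    using assms by (intro err[rule_format]) (simp add: power_le_one)
  then have "c \<noteq> 0"
    by (auto simp: s rel_error_def)
  obtain P Q where "is_quotient m l P Q r"
    using r by (auto simp: is_best_approx_def is_arg_min_def rat_type_def)
  then have "is_quotient m l (smult c P) Q s"
    using \<open>c \<noteq> 0\<close> by (auto simp: is_quotient_def s coprime_smult)
  then show ?thesis by blast
qed

text \<open>
  Let \<open>f\<close> be the ratio of the unscaled best approximant to the square root. Minimality
  against the competitor \<open>R\<close> puts \<open>f\<close> into \<open>[1 - \<epsilon>, 1 + \<epsilon>]\<close>. At a point where the scaled error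
  vanishes the scaling factor is the reciprocal of \<open>f\<close>, so the scaled error is at most
  \<open>(1 + \<epsilon>) / (1 - \<epsilon>) - 1\<close>, which is at most \<open>4 \<epsilon>\<close> when \<open>\<epsilon> \<le> 1 / 2\<close>.
\<close>

lemma scaled_best_approx_error:
  assumes "0 < \<alpha>" "\<alpha> < 1" and best: "is_scaled_best_approx m l \<alpha> s"
    and R: "R \<in> rat_type m l" "\<And>z. z \<in> {\<alpha>\<^sup>2..1} \<Longrightarrow> \<bar>rel_error R z\<bar> \<le> \<epsilon>"
    and "\<epsilon> \<le> 1 / 2" and z: "z \<in> {\<alpha>\<^sup>2..1}"
  shows "\<bar>rel_error s z\<bar> \<le> 4 * \<epsilon>"
proof -
  obtain r c where r: "is_best_approx m l \<alpha> r" and s: "s = (\<lambda>z. c * r z)"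
    and err: "\<forall>z\<in>{\<alpha>\<^sup>2..1}. 0 \<le> rel_error s z"
    and "\<exists>z\<in>{\<alpha>\<^sup>2..1}. rel_error s z = 0"
    using best by (auto simp: is_scaled_best_approx_def)
  then obtain y where y: "y \<in> {\<alpha>\<^sup>2..1}" "rel_error s y = 0"
    by blast
  have pos: "0 < sqrt x" if "x \<in> {\<alpha>\<^sup>2..1}" for x
    using that less_le_trans[OF zero_less_power[OF assms(1), of 2]] by auto
  have "max_rel_error \<alpha> r \<le> max_rel_error \<alpha> R"
    using r R(1) by (auto simp: is_best_approx_def is_arg_min_def not_less)
  also have "\<dots> \<le> ereal \<epsilon>"
    unfolding max_rel_error_def using R(2) by (intro SUP_least) auto
  finally have max: "max_rel_error \<alpha> r \<le> ereal \<epsilon>" .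
  define f where "f x = r x / sqrt x" for x
  have f: "1 - \<epsilon> \<le> f x" "f x \<le> 1 + \<epsilon>" if "x \<in> {\<alpha>\<^sup>2..1}" for x
  proof -
    have "ereal \<bar>rel_error r x\<bar> \<le> ereal \<epsilon>"
      using max that unfolding max_rel_error_def SUP_le_iff by blast
    then have "\<bar>rel_error r x\<bar> \<le> \<epsilon>"
      by simp
    moreover have "rel_error r x = f x - 1"
      using pos[OF that] by (simp add: rel_error_def f_def field_simps)
    ultimately show "1 - \<epsilon> \<le> f x" "f x \<le> 1 + \<epsilon>"
      by auto
  qed
  have es: "rel_error s x = c * f x - 1" if "x \<in> {\<alpha>\<^sup>2..1}" for x
    using pos[OF that] by (simp add: rel_error_def f_def s field_simps)
  have eps0: "0 \<le> \<epsilon>"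
    using f[OF z] by linarith
  have fy: "1 / 2 \<le> f y"
    using f(1)[OF y(1)] assms(6) by linarith
  have cy: "c * f y = 1"
    using y es by simp
  then have c: "c = 1 / f y"
    using fy by (simp add: field_simps)
  have "f z - f y \<le> 2 * \<epsilon>"
    using f(2)[OF z] f(1)[OF y(1)] by linarith
  also have "\<dots> \<le> 4 * \<epsilon> * f y"
    using mult_left_mono[OF fy, of "4 * \<epsilon>"] eps0 by simp
  finally have "c * f z - 1 \<le> 4 * \<epsilon>"
    using fy by (simp add: c field_simps)
  with err z es show ?thesis
    by auto
qed

text \<open>
  The competitor is the Pade approximant. Its relative error is \<open>(1 - \<surd>x) ^ n\<close> divided by
  \<open>\<surd>x\<close> times the value of the denominator; the first factor is at least \<open>1 / 2\<close> and the
  second at least \<open>1\<close>. Positivity is recorded because it shows that the denominator of \<open>s\<close> has no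
  zero at \<open>z\<close>, division by zero giving the value \<open>0\<close>.
\<close>

lemma scaled_best_approx_close:
  assumes "m \<ge> 1" "l \<in> {m - 1, m}" and "1 / 2 \<le> \<alpha>" "\<alpha> < 1"
    and best: "is_scaled_best_approx m l \<alpha> s"
    and small: "(1 - \<alpha>\<^sup>2) ^ (m + l + 1) \<le> 1 / 4" and z: "z \<in> {\<alpha>\<^sup>2..1}"
  shows "0 < s z" "\<bar>s z - sqrt z\<bar> \<le> 8 * (1 - \<alpha>\<^sup>2) ^ (m + l + 1)"
proof -
  define n where "n = m + l + 1"
  define A B where "A = binomial_even n" and "B = binomial_odd n"
  define R where "R z = poly A z / poly B z" for z
  have "is_quotient m l A B R"
    using degree_binomial_even[OF assms(2,1)] degree_binomial_odd[OF assms(2,1)]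
      coprime_binomial_even_odd binomial_odd_ge_1[of 0 n]
    by (auto simp: is_quotient_def A_def B_def n_def R_def)
  then have "R \<in> rat_type m l"
    by (auto simp: rat_type_def)
  moreover have root: "1 / 2 \<le> sqrt x" "sqrt x \<le> 1" if "x \<in> {\<alpha>\<^sup>2..1}" for x
    using that assms real_sqrt_le_mono[of "\<alpha>\<^sup>2" x] by auto
  have "\<bar>rel_error R x\<bar> \<le> 2 * (1 - \<alpha>\<^sup>2) ^ n" if x: "x \<in> {\<alpha>\<^sup>2..1}" for x
  proof -
    have x0: "0 \<le> x"
      using x zero_le_power2[of \<alpha>] unfolding atLeastAtMost_iff by linarith
    have B1: "1 \<le> poly B x"
      using x0 by (simp add: B_def binomial_odd_ge_1 n_def)
    have "\<bar>poly A x - sqrt x * poly B x\<bar> \<le> (1 - x) ^ n"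
      unfolding A_def B_def using x x0 by (intro binomial_even_minus_odd_bound) auto
    also have "\<dots> \<le> (1 - \<alpha>\<^sup>2) ^ n"
      using x by (intro power_mono) auto
    finally have num: "\<bar>poly A x - sqrt x * poly B x\<bar> \<le> (1 - \<alpha>\<^sup>2) ^ n" .
    have "1 / 2 * 1 \<le> sqrt x * poly B x"
      using root[OF x] B1 x0 by (intro mult_mono) auto
    then have den: "1 / 2 \<le> sqrt x * poly B x"
      by simp
    have "rel_error R x = (poly A x - sqrt x * poly B x) / (sqrt x * poly B x)"
      using root[OF x] B1 x0 by (auto simp: rel_error_def R_def divide_simps)
    then have "\<bar>rel_error R x\<bar> = \<bar>poly A x - sqrt x * poly B x\<bar> / (sqrt x * poly B x)"
      using den by simp
    also have "\<dots> \<le> (1 - \<alpha>\<^sup>2) ^ n / (1 / 2)"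
      using num den x by (intro frac_le) auto
    finally show ?thesis by simp
  qed
  ultimately have err: "\<bar>rel_error s z\<bar> \<le> 4 * (2 * (1 - \<alpha>\<^sup>2) ^ n)"
    using assms by (intro scaled_best_approx_error[OF _ _ best]) (auto simp: n_def)
  have "0 \<le> rel_error s z"
    using best z by (auto simp: is_scaled_best_approx_def)
  then have "sqrt z \<le> s z"
    using root[OF z] by (simp only: rel_error_def zero_le_divide_iff) linarith
  then show "0 < s z"
    using root[OF z] by linarith
  have "s z - sqrt z = rel_error s z * sqrt z"
    using root[OF z] by (auto simp: rel_error_def)
  then have "\<bar>s z - sqrt z\<bar> = \<bar>rel_error s z\<bar> * sqrt z"
    using root[OF z] by (simp only: abs_mult)
  also have "\<dots> \<le> \<bar>rel_error s z\<bar>"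
    using root[OF z] by (intro mult_left_le) auto
  finally show "\<bar>s z - sqrt z\<bar> \<le> 8 * (1 - \<alpha>\<^sup>2) ^ (m + l + 1)"
    using err by (simp add: n_def)
qed

section \<open>Convergence to the Pade approximant\<close>

theorem proposition2p4:
  fixes m l :: nat
    and rhat :: "real \<Rightarrow> real \<Rightarrow> real"
    and p :: "real \<Rightarrow> real"
  assumes "m \<ge> 1" and "l \<in> {m - 1, m}"
    and "\<And>\<alpha>. \<alpha> \<in> {0<..<1} \<Longrightarrow> is_scaled_best_approx m l \<alpha> (rhat \<alpha>)"
    and "is_pade_sqrt m l p"
  shows "converges_coeffwise m l rhat p"
proof -
  define n where "n = m + l + 1"
  define A B where "A = binomial_even n" and "B = binomial_odd n"
  have p: "is_quotient m l A B p"
    unfolding A_def B_def n_def by (rule pade_sqrt_is_binomial_quotient) fact+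
  have degB: "degree B = l"
    using degree_binomial_odd[OF assms(2,1)] by (simp add: B_def n_def)
  \<comment> \<open>Outside \<open>(0, 1)\<close> nothing is known about \<open>rhat\<close>; filling in \<open>p\<close> there keeps the choice of \<open>P\<close> and \<open>Q\<close> total.\<close>
  define s where "s \<alpha> = (if \<alpha> \<in> {0<..<1} then rhat \<alpha> else p)" for \<alpha>
  have "\<exists>P Q. is_quotient m l P Q (s \<alpha>)" for \<alpha>
    using p scaled_best_approx_is_quotient[OF _ _ assms(3)[of \<alpha>]] by (auto simp: s_def)
  then have "\<exists>P Q. is_quotient m l P Q (s \<alpha>) \<and> (\<Sum>i\<le>l. \<bar>coeff Q i\<bar>) = 1" for \<alpha>
    using quotient_normalize by blast
  then obtain P Q where PQ: "\<And>\<alpha>. is_quotient m l (P \<alpha>) (Q \<alpha>) (s \<alpha>)"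
    and norm: "\<And>\<alpha>. (\<Sum>i\<le>l. \<bar>coeff (Q \<alpha>) i\<bar>) = 1"
    by metis
  have degP: "degree (P \<alpha>) \<le> m" and degQ: "degree (Q \<alpha>) \<le> l" for \<alpha>
    using PQ[of \<alpha>] by (simp_all add: is_quotient_def)
  define b where "b = (\<Sum>i\<le>l. \<bar>coeff B i\<bar>)"
  define h where "h \<alpha> = 1 - \<alpha>\<^sup>2" for \<alpha> :: real
  have h0: "(h \<longlongrightarrow> 0) (at_left 1)"
  proof -
    have "((\<lambda>\<alpha>. 1 - \<alpha>\<^sup>2) \<longlongrightarrow> 1 - 1\<^sup>2) (at_left (1 :: real))"
      by (intro tendsto_intros)
    then show ?thesis by (simp add: h_def[abs_def])
  qed
  have "((\<lambda>\<alpha>. h \<alpha> ^ n) \<longlongrightarrow> 0 ^ n) (at_left 1)"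
    by (intro tendsto_intros h0)
  then have hsmall: "\<forall>\<^sub>F \<alpha> in at_left 1. h \<alpha> ^ n < 1 / 4"
    by (rule order_tendstoD(2)) (simp add: n_def)
  have near: "\<forall>\<^sub>F \<alpha> in at_left (1::real). \<alpha> \<in> {1 / 2<..<1}"
    by (rule eventually_at_left_real) simp
  have D0: "((\<lambda>\<alpha>. coeff (P \<alpha> * B - A * Q \<alpha>) k) \<longlongrightarrow> 0) (at_left 1)" for k
  proof (rule coeff_tendsto_0_if_small_on_shrinking_interval[OF _ h0])
    show "degree (P \<alpha> * B - A * Q \<alpha>) \<le> m + l" for \<alpha>
      using degP[of \<alpha>] degQ[of \<alpha>] degB p degree_mult_le[of "P \<alpha>" B] degree_mult_le[of A "Q \<alpha>"]
      by (intro degree_diff_le) (auto simp: is_quotient_def)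
    show "\<forall>\<^sub>F \<alpha> in at_left 1. 0 < h \<alpha>"
      using near by eventually_elim (auto simp: h_def power_less_one_iff)
    show "\<forall>\<^sub>F \<alpha> in at_left 1. \<forall>z\<in>{1 - h \<alpha>..<1}.
        \<bar>poly (P \<alpha> * B - A * Q \<alpha>) z\<bar> \<le> (8 * b + 1) * h \<alpha> ^ Suc (m + l)"
      using near hsmall
    proof eventually_elim
      case (elim \<alpha>)
      show ?case
      proof
        fix z assume z: "z \<in> {1 - h \<alpha>..<1}"
        then have z': "z \<in> {\<alpha>\<^sup>2..1}"
          by (simp add: h_def)
        have z0: "0 \<le> z"
          using z' zero_le_power2[of \<alpha>] unfolding atLeastAtMost_iff by linarith
        have best: "is_scaled_best_approx m l \<alpha> (s \<alpha>)"
          using assms(3) elim by (auto simp: s_def)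
        have pos: "0 < s \<alpha> z" and close: "\<bar>s \<alpha> z - sqrt z\<bar> \<le> 8 * h \<alpha> ^ n"
          using scaled_best_approx_close[OF assms(1,2) _ _ best _ z'] elim
          by (auto simp: h_def n_def)
        have "poly (Q \<alpha>) z \<noteq> 0" and "s \<alpha> z = poly (P \<alpha>) z / poly (Q \<alpha>) z"
          using PQ[of \<alpha>] pos by (auto simp: is_quotient_def)
        then have "poly (P \<alpha>) z = s \<alpha> z * poly (Q \<alpha>) z"
          by simp
        then have "\<bar>poly (P \<alpha> * B - A * Q \<alpha>) z\<bar>
            \<le> (\<Sum>i\<le>l. \<bar>coeff (Q \<alpha>) i\<bar>) * (8 * h \<alpha> ^ n * b + (1 - z) ^ n)"
          unfolding A_def B_def b_def
          using degQ[of \<alpha>] degB z z0 close by (intro cross_difference_bound) (auto simp: B_def)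
        also have "\<dots> = 8 * h \<alpha> ^ n * b + (1 - z) ^ n"
          by (simp add: norm)
        also have "\<dots> \<le> 8 * h \<alpha> ^ n * b + h \<alpha> ^ n"
          using z by (auto intro!: power_mono)
        finally show "\<bar>poly (P \<alpha> * B - A * Q \<alpha>) z\<bar> \<le> (8 * b + 1) * h \<alpha> ^ Suc (m + l)"
          by (simp add: n_def algebra_simps)
      qed
    qed
  qed
  have cop: "coprime A B" and "B \<noteq> 0"
    using p by (auto simp: is_quotient_def)
  obtain u where u: "\<And>\<alpha>. u \<alpha> \<noteq> 0"
    and lim: "\<And>k. ((\<lambda>\<alpha>. coeff (smult (u \<alpha>) (P \<alpha>)) k) \<longlongrightarrow> coeff A k) (at_left 1)"
      "\<And>k. ((\<lambda>\<alpha>. coeff (smult (u \<alpha>) (Q \<alpha>)) k) \<longlongrightarrow> coeff B k) (at_left 1)"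
    using normalized_quotients_tendsto[OF cop \<open>B \<noteq> 0\<close> degP degQ[folded degB] norm[folded degB] D0]
    by blast
  have "is_quotient m l (smult (u \<alpha>) (P \<alpha>)) (smult (u \<alpha>) (Q \<alpha>)) (rhat \<alpha>)" if "\<alpha> \<in> {0<..<1}" for \<alpha>
    using PQ[of \<alpha>] u[of \<alpha>] that
    by (auto simp: is_quotient_def s_def coprime_smult)
  with p lim show ?thesis
    unfolding converges_coeffwise_def
    by (intro exI[of _ "\<lambda>\<alpha>. smult (u \<alpha>) (P \<alpha>)"] exI[of _ "\<lambda>\<alpha>. smult (u \<alpha>) (Q \<alpha>)"]
        exI[of _ A] exI[of _ B]) blast
qed

end
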